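(* Let $d\ge3$, $W\in\mathcal S(\mathbb R^d)$ real-valued, $\lambda>0$ sufficiently small that the on-shell $T$-matrix $T(y,y')$ is defined by its absolutely convergent perturbation series. For $u=(u_1,u_2)$ with $u_1,u_2>0$, the one-collision densities $\rho^{(2)}_{\ell m}$, $\ell,m\in\{1,2\}$, satisfy $$\rho^{(2)}_{11}(u,y_1,y_2)=\rho^{(2)}_{\mathrm{LB}}(u,y_1,y_2)\,\left|\frac{u_1T(y_2,y_1)}{u_2T(y_1,y_2)}\right|\,\Big|J_1\big(4\pi[u_1u_2T(y_1,y_2)T(y_2,y_1)]^{1/2}\big)\Big|^2$$ (where $T(y_1,y_2)\neq0$), and $$\rho^{(2)}_{12}(u,y_1,y_2)=\rho^{(2)}_{\mathrm{LB}}(u,y_1,y_2)\,\Big|J_0\big(4\pi[u_1u_2T(y_1,y_2)T(y_2,y_1)]^{1/2}\big)\Big|^2,$$ and moreover $$\rho^{(2)}_{22}(u_1,u_2,y_1,y_2)=\rho^{(2)}_{11}(u_2,u_1,y_2,y_1),\qquad \rho^{(2)}_{21}(u_1,u_2,y_1,y_2)=\rho^{(2)}_{12}(u_2,u_1,y_2,y_1).$$ Here $J_0,J_1$ are the $J$-Bessel functions and any fixed branch of the square root may be used.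
   Context: $e(z)=e^{2\pi iz}$, $\hat W(y)=\int W(x)e(-x\cdot y)\,dx$. The on-shell $T$-matrix is $T(y,y')=\sum_{n\ge1}\lambda^nT_n(y,y')$ with $T_1(y_0,y_1)=\hat W(y_0-y_1)$ and, for $n\ge2$, $$T_n(y_0,y_n)=(-2\pi i)^{n-1}\int_{\mathbb R_{\ge0}^{n-1}}\Big\{\int_{(\mathbb R^d)^{n-1}}\prod_{j=0}^{n-1}\hat W(y_j-y_{j+1})\;e\Big(\sum_{j=1}^{n-1}\theta_j(\tfrac12\|y_0\|^2-\tfrac12\|y_j\|^2)\Big)dy_1\cdots dy_{n-1}\Big\}d\theta_1\cdots d\theta_{n-1}.$$ $\Sigma(y,y')=4\pi^2|T(y,y')|^2\,\delta(\tfrac12\|y\|^2-\tfrac12\|y'\|^2)$, $\Sigma_{\rm tot}(y)=\int_{\mathbb R^d}\Sigma(y',y)\,dy'$. The linear Boltzmann one-collision density is $\rho^{(2)}_{\mathrm{LB}}(u,y_1,y_2)=e^{-u_1\Sigma_{\rm tot}(y_1)-u_2\Sigma_{\rm tot}(y_2)}\,\Sigma(y_1,y_2)$. The one-collision densities are $$\rho^{(2)}_{\ell m}(u,y_1,y_2)=|g^{(2)}_{\ell m}(u,y_1,y_2)|^2\,\delta(\tfrac12\|y_1\|^2-\tfrac12\|y_2\|^2)\,e^{-u_1\Sigma_{\rm tot}(y_1)-u_2\Sigma_{\rm tot}(y_2)},$$ where $g^{(2)}_{\ell m}$ are the entries of $$\mathbb G^{(2)}(u,y_1,y_2)=\frac1{(2\pi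 i)^2}\oint\oint\begin{pmatrix}z_1&2\pi iT(y_1,y_2)\\2\pi iT(y_2,y_1)&z_2\end{pmatrix}^{-1}e^{u_1z_1+u_2z_2}\,dz_1\,dz_2,$$ with counterclockwise circles around the origin of radius strictly greater than $4\pi\max\{|T(y_1,y_2)|,|T(y_2,y_1)|\}$. The identities are between distributions of the form (function)$\times\delta(\tfrac12\|y_1\|^2-\tfrac12\|y_2\|^2)$, i.e. the function factors agree. *)

theory Defs
  imports "HOL-Complex_Analysis.Complex_Analysis"
begin

definition partial_deriv :: "'d \<Rightarrow> (real^'d \<Rightarrow> real) \<Rightarrow> real^'d \<Rightarrow> real" where
  "partial_deriv i f x = deriv (\<lambda>t. f (x + t *\<^sub>R axis i 1)) 0"

fun iter_partial :: "'d list \<Rightarrow> (real^'d \<Rightarrow> real) \<Rightarrow> real^'d \<Rightarrow> real" where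
  "iter_partial [] f = f"
| "iter_partial (i # is) f = partial_deriv i (iter_partial is f)"

text \<open>All iterated partial derivatives exist, are differentiable (hence \<open>f\<close> is smooth),
  and decay faster than any power of the norm.\<close>

definition schwartz :: "(real^'d \<Rightarrow> real) \<Rightarrow> bool" where
  "schwartz f \<longleftrightarrow>
     (\<forall>is. (\<forall>x. iter_partial is f differentiable (at x)) \<and>
           (\<forall>k::nat. \<exists>C. \<forall>x. norm x ^ k * \<bar>iter_partial is f x\<bar> \<le> C))"

definition e2pi :: "complex \<Rightarrow> complex" where
  "e2pi z = exp (2 * of_real pi * \<i> * z)"

definition W_hat :: "(real^'d \<Rightarrow> real) \<Rightarrow> real^'d \<Rightarrow> complex" where
  "W_hat W y = (LINT x|lborel. of_real (W x) * e2pi (of_real (- (x \<bullet> y))))"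

text \<open>The integration variables \<open>y\<^sub>1, \<dots>, y\<^sub>n\<^sub>-\<^sub>1\<close> and \<open>\<theta>\<^sub>1, \<dots>, \<theta>\<^sub>n\<^sub>-\<^sub>1\<close> are families indexed by
  \<open>{1..<n}\<close>; \<open>path_pt\<close> completes the former by the fixed end points \<open>y\<^sub>0\<close> and \<open>y\<^sub>n\<close>.\<close>

definition path_pt :: "nat \<Rightarrow> real^'d \<Rightarrow> real^'d \<Rightarrow> (nat \<Rightarrow> real^'d) \<Rightarrow> nat \<Rightarrow> real^'d" where
  "path_pt n y0 yn y j = (if j = 0 then y0 else if j = n then yn else y j)"

definition T_inner ::
    "(real^'d \<Rightarrow> real) \<Rightarrow> nat \<Rightarrow> real^'d \<Rightarrow> real^'d \<Rightarrow> (nat \<Rightarrow> real) \<Rightarrow> complex" where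
  "T_inner W n y0 yn \<theta> =
     (LINT y|Pi\<^sub>M {1..<n} (\<lambda>_. lborel).
        (\<Prod>j<n. W_hat W (path_pt n y0 yn y j - path_pt n y0 yn y (Suc j))) *
        e2pi (of_real (\<Sum>j=1..<n. \<theta> j * ((norm y0)\<^sup>2 / 2 - (norm (y j))\<^sup>2 / 2))))"

definition T_coeff :: "(real^'d \<Rightarrow> real) \<Rightarrow> nat \<Rightarrow> real^'d \<Rightarrow> real^'d \<Rightarrow> complex" where
  "T_coeff W n y0 yn =
     (if n = 1 then W_hat W (y0 - yn)
      else (- 2 * of_real pi * \<i>) ^ (n - 1) *
        (LINT \<theta>:(\<Pi>\<^sub>E j\<in>{1..<n}. {0..})|Pi\<^sub>M {1..<n} (\<lambda>_. lborel). T_inner W n y0 yn \<theta>))"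

definition T_matrix :: "(real^'d \<Rightarrow> real) \<Rightarrow> real \<Rightarrow> real^'d \<Rightarrow> real^'d \<Rightarrow> complex" where
  "T_matrix W lam y y' = (\<Sum>n. of_real lam ^ Suc n * T_coeff W (Suc n) y y')"

definition on_shell :: "real^'d \<Rightarrow> real^'d \<Rightarrow> bool" where
  "on_shell y y' \<longleftrightarrow> (norm y)\<^sup>2 / 2 = (norm y')\<^sup>2 / 2"

definition T_series_converges :: "(real^'d \<Rightarrow> real) \<Rightarrow> real \<Rightarrow> bool" where
  "T_series_converges W lam \<longleftrightarrow>
     (\<forall>y y'. on_shell y y' \<longrightarrow>
        summable (\<lambda>n. norm (of_real lam ^ Suc n * T_coeff W (Suc n) y y')))"

text \<open>Surface measure on the unit sphere: \<open>d\<close> times the volume of the cone over a set.\<close>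

definition sphere_measure :: "(real^'d) measure" where
  "sphere_measure =
     scale_measure (of_nat CARD('d)) (distr (restrict_space lborel (ball 0 1)) borel sgn)"

text \<open>\<open>shell_integral f y\<close> is \<open>\<integral> f(y') \<delta>(\<parallel>y'\<parallel>\<^sup>2/2 - \<parallel>y\<parallel>\<^sup>2/2) dy'\<close>.  In polar coordinates
  \<open>y' = r \<omega>\<close> one has \<open>dy' = r\<^sup>d\<^sup>-\<^sup>2 d(r\<^sup>2/2) d\<omega>\<close>, whence the factor \<open>\<parallel>y\<parallel>\<^sup>d\<^sup>-\<^sup>2\<close>.
  Only used for \<open>d \<ge> 3\<close>.\<close>

definition shell_integral :: "(real^'d \<Rightarrow> real) \<Rightarrow> real^'d \<Rightarrow> real" where
  "shell_integral f y =
     norm y ^ (CARD('d) - 2) * (LINT \<omega>|sphere_measure. f (norm y *\<^sub>R \<omega>))"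

text \<open>\<open>\<Sigma>\<close>, \<open>\<rho>\<^sub>L\<^sub>B\<close> and \<open>\<rho>\<^sub>l\<^sub>m\<close> are distributions of the form (function) times
  \<open>\<delta>(\<parallel>y\<parallel>\<^sup>2/2 - \<parallel>y'\<parallel>\<^sup>2/2)\<close>.  Such a distribution is represented by its function factor; two of
  them are equal when the factors agree for all pairs satisfying \<open>on_shell\<close>.\<close>

definition Sigma_factor :: "(real^'d \<Rightarrow> real) \<Rightarrow> real \<Rightarrow> real^'d \<Rightarrow> real^'d \<Rightarrow> real" where
  "Sigma_factor W lam y y' = 4 * pi\<^sup>2 * (norm (T_matrix W lam y y'))\<^sup>2"

definition Sigma_tot :: "(real^'d \<Rightarrow> real) \<Rightarrow> real \<Rightarrow> real^'d \<Rightarrow> real" where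
  "Sigma_tot W lam y = shell_integral (\<lambda>y'. Sigma_factor W lam y' y) y"

definition rho_LB_factor ::
    "(real^'d \<Rightarrow> real) \<Rightarrow> real \<Rightarrow> real \<Rightarrow> real \<Rightarrow> real^'d \<Rightarrow> real^'d \<Rightarrow> real" where
  "rho_LB_factor W lam u1 u2 y1 y2 =
     exp (- u1 * Sigma_tot W lam y1 - u2 * Sigma_tot W lam y2) * Sigma_factor W lam y1 y2"

definition resolvent_arg ::
    "(real^'d \<Rightarrow> real) \<Rightarrow> real \<Rightarrow> real^'d \<Rightarrow> real^'d \<Rightarrow> complex \<Rightarrow> complex \<Rightarrow> complex^2^2" where
  "resolvent_arg W lam y1 y2 z1 z2 =
     vector [vector [z1, 2 * of_real pi * \<i> * T_matrix W lam y1 y2],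
             vector [2 * of_real pi * \<i> * T_matrix W lam y2 y1, z2]]"

text \<open>\<open>r1\<close> and \<open>r2\<close> are the radii of the circles for \<open>z1\<close> and \<open>z2\<close>.\<close>

definition G_matrix ::
    "(real^'d \<Rightarrow> real) \<Rightarrow> real \<Rightarrow> real \<Rightarrow> real \<Rightarrow> real \<Rightarrow> real \<Rightarrow> real^'d \<Rightarrow> real^'d \<Rightarrow> complex^2^2" where
  "G_matrix W lam r1 r2 u1 u2 y1 y2 =
     (\<chi> l m. 1 / (2 * of_real pi * \<i>)\<^sup>2 *
        contour_integral (circlepath 0 r1) (\<lambda>z1.
          contour_integral (circlepath 0 r2) (\<lambda>z2.
            matrix_inv (resolvent_arg W lam y1 y2 z1 z2) $ l $ m *
            exp (of_real u1 * z1 + of_real u2 * z2))))"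

definition admissible_radius ::
    "(real^'d \<Rightarrow> real) \<Rightarrow> real \<Rightarrow> real^'d \<Rightarrow> real^'d \<Rightarrow> real \<Rightarrow> bool" where
  "admissible_radius W lam y1 y2 r \<longleftrightarrow>
     r > 4 * pi * max (norm (T_matrix W lam y1 y2)) (norm (T_matrix W lam y2 y1))"

definition rho_factor ::
    "(real^'d \<Rightarrow> real) \<Rightarrow> real \<Rightarrow> real \<Rightarrow> real \<Rightarrow> 2 \<Rightarrow> 2 \<Rightarrow> real \<Rightarrow> real \<Rightarrow> real^'d \<Rightarrow> real^'d \<Rightarrow> real" where
  "rho_factor W lam r1 r2 l m u1 u2 y1 y2 =
     (norm (G_matrix W lam r1 r2 u1 u2 y1 y2 $ l $ m))\<^sup>2 *
     exp (- u1 * Sigma_tot W lam y1 - u2 * Sigma_tot W lam y2)"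

definition bessel_J :: "nat \<Rightarrow> complex \<Rightarrow> complex" where
  "bessel_J n z =
     (\<Sum>k. (- 1) ^ k / (of_nat (fact k) * of_nat (fact (k + n))) * (z / 2) ^ (2 * k + n))"

end

theory Submission
  imports Defs
begin

text \<open>With \<open>a = 2\<pi>i T(y\<^sub>1,y\<^sub>2)\<close>, \<open>b = 2\<pi>i T(y\<^sub>2,y\<^sub>1)\<close> and \<open>p = ab\<close>, every entry of the inverse matrix has the
  denominator \<open>z\<^sub>1z\<^sub>2 - p\<close>.  Since \<open>|p| < r\<^sub>1r\<^sub>2\<close>, the inner integral only sees the simple pole
  \<open>z\<^sub>2 = p/z\<^sub>1\<close>, which leaves \<open>exp (u\<^sub>1z + u\<^sub>2p/z)\<close> times a power of \<open>z\<close>.  Its residue at the essential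
  singularity \<open>0\<close> is a power series in \<open>u\<^sub>1u\<^sub>2p = -4\<pi>\<^sup>2u\<^sub>1u\<^sub>2T(y\<^sub>1,y\<^sub>2)T(y\<^sub>2,y\<^sub>1)\<close>, and this is the
  series of \<open>J\<^sub>0\<close> or \<open>J\<^sub>1\<close> with a power of its argument removed.\<close>

section \<open>The inverse of a 2 by 2 matrix\<close>

lemma matrix_inv_eqI:
  fixes A B :: "'a::comm_ring_1^'n^'n"
  assumes "A ** B = mat 1" and "B ** A = mat 1"
  shows "matrix_inv A = B"
proof -
  \<comment> \<open>\<open>matrix_inv\<close> is a Hilbert choice: \<open>B\<close> only witnesses
    that a two-sided inverse exists, and associativity then forces the chosen one to be
    \<open>B\<close>.\<close>
  have "A ** matrix_inv A = mat 1 \<and> matrix_inv A ** A = mat 1"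
    unfolding matrix_inv_def by (rule someI[of _ B]) (use assms in simp)
  then have "matrix_inv A = (B ** A) ** matrix_inv A"
    using assms by simp
  also have "\<dots> = B ** (A ** matrix_inv A)"
    by (rule matrix_mul_assoc[symmetric])
  also have "\<dots> = B"
    using \<open>A ** matrix_inv A = mat 1 \<and> _\<close> by simp
  finally show ?thesis .
qed

lemma matrix_inv_2:
  fixes x a b y :: "'a::field"
  assumes "x * y - a * b \<noteq> 0"
  shows "matrix_inv (vector [vector [x, a], vector [b, y]] :: 'a^2^2) =
    vector [vector [y / (x * y - a * b), - a / (x * y - a * b)],
            vector [- b / (x * y - a * b), x / (x * y - a * b)]]"
proof -
  define D where "D = x * y - a * b"
  have D: "D \<noteq> 0" "x * y = D + a * b"
    using assms by (simp_all add: D_def)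
  \<comment> \<open>This settles the diagonal entries of both products, which are
    \<open>x * y / D - a * b / D\<close> up to the order of factors.\<close>
  then have "x * y / D = 1 + a * b / D"
    by (simp add: add_divide_distrib)
  then show ?thesis
    unfolding D_def[symmetric] using D(1)
    by (intro matrix_inv_eqI)
       (auto simp: vec_eq_iff forall_2 matrix_matrix_mult_def sum_2 mat_def mult.commute)
qed

section \<open>Integrals over a single circle and their closed forms by Bessel series\<close>

lemma higher_deriv_exp_scaled:
  "(deriv ^^ k) (\<lambda>z. exp (u * z)) = (\<lambda>z::complex. u ^ k * exp (u * z))"
proof (induction k)
  case (Suc k)
  have "deriv (\<lambda>z. u ^ k * exp (u * z)) z = u ^ Suc k * exp (u * z)" for z
    by (rule DERIV_imp_deriv) (auto intro!: derivative_eq_intros)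
  then show ?case
    by (auto simp: Suc fun_eq_iff)
qed simp

text \<open>Cauchy's formula for the derivative of order \<open>n - 1\<close> at 0. For
  \<open>n = 0\<close> the integrand is entire; truncated subtraction would turn the quotient into 1
  there, hence the separate value 0.\<close>

lemma has_contour_integral_exp_div_power:
  assumes "r > 0"
  shows "((\<lambda>z. exp (u * z) / z ^ n) has_contour_integral
          (2 * of_real pi * \<i> * (if n = 0 then 0 else u ^ (n - 1) / fact (n - 1)))) (circlepath 0 r)"
proof (cases n)
  case 0
  have "(\<lambda>z. exp (u * z)) holomorphic_on UNIV"
    by (intro holomorphic_intros)
  from Cauchy_theorem_convex_simple[OF this, of "circlepath 0 r"] show ?thesis
    using 0 by simp
next
  case (Suc k)
  have "(\<lambda>z. exp (u * z)) holomorphic_on UNIV"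
    by (intro holomorphic_intros)
  then have "((\<lambda>z. exp (u * z) / (z - 0) ^ Suc k) has_contour_integral
      (2 * pi * \<i> / fact k * (deriv ^^ k) (\<lambda>z. exp (u * z)) 0)) (circlepath 0 r)"
    using assms by (intro Cauchy_has_contour_integral_higher_derivative_circlepath)
      (auto intro: holomorphic_on_subset holomorphic_on_imp_continuous_on)
  then show ?thesis
    using Suc by (simp add: higher_deriv_exp_scaled)
qed

text \<open>Only \<open>exp (v / z)\<close> is expanded, while \<open>exp (u * z)\<close> stays
  whole. The series converges uniformly on the circle and is integrated term by term.\<close>

lemma contour_integral_exp_exp_inverse_sums:
  assumes "r > 0"
  shows "(\<lambda>k. 2 * of_real pi * \<i> * (v ^ k / fact k *
            (if k + n = 0 then 0 else u ^ (k + n - 1) / fact (k + n - 1)))) sums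
         contour_integral (circlepath 0 r) (\<lambda>z. exp (u * z + v / z) / z ^ n)"
proof -
  define f where "f k z = v ^ k / fact k * (exp (u * z) / z ^ (k + n))" for k and z :: complex
  define c where "c k = 2 * of_real pi * \<i> * (v ^ k / fact k *
      (if k + n = 0 then 0 else u ^ (k + n - 1) / fact (k + n - 1)))" for k
  \<comment> \<open>On the circle \<open>exp (u * z)\<close> has norm at most
    \<open>exp (norm u * r)\<close> and \<open>v / z\<close> has norm \<open>norm v / r\<close>, so
    \<open>M\<close> is a multiple of an exponential series.\<close>
  define M where "M k = exp (norm u * r) / r ^ n * ((norm v / r) ^ k /\<^sub>R fact k)" for k
  have f_int: "(f k has_contour_integral c k) (circlepath 0 r)" for k
    using has_contour_integral_lmul[OF has_contour_integral_exp_div_power[OF assms, of u "k + n"],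
        of "v ^ k / fact k"]
    by (simp add: f_def[abs_def] c_def mult_ac)
  have f_eq: "f k z = exp (u * z) / z ^ n * ((v / z) ^ k /\<^sub>R fact k)" for k z
    by (simp add: f_def power_add scaleR_conv_of_real power_divide inverse_eq_divide mult_ac)
  \<comment> \<open>As division by zero gives zero, this holds at \<open>z = 0\<close> too, so the
    limit function can later be rewritten without a side condition on \<open>z\<close>.\<close>
  have f_sums: "(\<lambda>k. f k z) sums (exp (u * z + v / z) / z ^ n)" for z
    using sums_mult[OF exp_converges[of "v / z"], of "exp (u * z) / z ^ n"]
    by (simp add: f_eq exp_add)
  have "uniform_limit (sphere 0 r) (\<lambda>N z. \<Sum>k<N. f k z) (\<lambda>z. \<Sum>k. f k z) sequentially"
  proof (rule Weierstrass_m_test)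
    fix k and z :: complex
    assume "z \<in> sphere 0 r"
    then have z: "norm z = r" by simp
    have "Re (u * z) \<le> norm u * r"
      using complex_Re_le_cmod[of "u * z"] z by (simp add: norm_mult)
    then have "norm (exp (u * z)) / r ^ n * ((norm v / r) ^ k /\<^sub>R fact k) \<le> M k"
      unfolding M_def using assms by (intro mult_right_mono divide_right_mono) auto
    then show "norm (f k z) \<le> M k"
      using z by (simp add: f_eq norm_mult norm_divide norm_power mult_ac)
  next
    show "summable M"
      unfolding M_def by (intro summable_mult sums_summable[OF exp_converges])
  qed
  then have lim: "uniform_limit (sphere 0 r) (\<lambda>N z. \<Sum>k<N. f k z)
      (\<lambda>z. exp (u * z + v / z) / z ^ n) sequentially"
    by (simp only: sums_unique[OF f_sums, symmetric])
  have sum_int: "((\<lambda>z. \<Sum>k<N. f k z) has_contour_integral (\<Sum>k<N. c k)) (circlepath 0 r)" for N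
    by (intro has_contour_integral_sum f_int) simp
  have "(\<lambda>N. contour_integral (circlepath 0 r) (\<lambda>z. \<Sum>k<N. f k z)) \<longlonglongrightarrow>
      contour_integral (circlepath 0 r) (\<lambda>z. exp (u * z + v / z) / z ^ n)"
    using lim assms
    by (intro contour_integral_uniform_limit_circlepath(2) always_eventually allI
        has_contour_integral_integrable[OF sum_int]) simp_all
  then show ?thesis
    by (simp add: contour_integral_unique[OF sum_int] sums_def c_def)
qed

text \<open>Cauchy's integral formula: \<open>z * w - p = z * (w - p / z)\<close> vanishes only at
  \<open>p / z\<close>, inside the circle. The constant \<open>c\<close> is meant for the factor
  that depends on the outer variable.\<close>

lemma contour_integral_pole_divide:
  assumes "r > 0" and "z \<noteq> 0" and "norm (p / z) < r" and "f holomorphic_on UNIV"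
  shows "contour_integral (circlepath 0 r) (\<lambda>w. c * (f w / (z * w - p))) =
    2 * of_real pi * \<i> * (c * f (p / z) / z)"
proof -
  have "((\<lambda>w. f w / (w - p / z)) has_contour_integral 2 * of_real pi * \<i> * f (p / z))
      (circlepath 0 r)"
    using assms by (intro Cauchy_integral_circlepath_simple) (auto intro: holomorphic_on_subset)
  from has_contour_integral_lmul[OF this, of "c / z"]
  have "((\<lambda>w. c / z * (f w / (w - p / z))) has_contour_integral
      2 * of_real pi * \<i> * (c * f (p / z) / z)) (circlepath 0 r)"
    by (simp add: mult_ac)
  moreover have "c / z * (f w / (w - p / z)) = c * (f w / (z * w - p))" for w
  proof -
    have "z * w - p = z * (w - p / z)"
      using assms(2) by (simp add: algebra_simps)
    then show ?thesis
      by simp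
  qed
  ultimately have "((\<lambda>w. c * (f w / (z * w - p))) has_contour_integral
      2 * of_real pi * \<i> * (c * f (p / z) / z)) (circlepath 0 r)"
    by (simp only:)
  then show ?thesis
    by (rule contour_integral_unique)
qed

text \<open>The Bessel-Clifford function, that is \<open>J_n\<close> without its power of the
  argument. It is entire in \<open>t\<close>, so the residues can be stated without a square
  root.\<close>

definition bessel_kernel :: "nat \<Rightarrow> complex \<Rightarrow> complex" where
  "bessel_kernel n t = (\<Sum>k. t ^ k / (fact k * fact (k + n)))"

lemma bessel_kernel_sums:
  "(\<lambda>k. t ^ k / (fact k * fact (k + n))) sums bessel_kernel n t"
proof -
  have "summable (\<lambda>k. t ^ k / (fact k * fact (k + n)))"
  proof (rule summable_comparison_test'[OF summable_norm_exp])
    fix k :: nat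
    have "norm (t ^ k / (fact k * fact (k + n))) = norm t ^ k / fact k * (1 / fact (k + n))"
      by (simp add: norm_divide norm_mult norm_power)
    also have "\<dots> \<le> norm t ^ k / fact k * 1"
      by (intro mult_left_mono) (auto simp: fact_ge_1)
    also have "\<dots> = norm (t ^ k /\<^sub>R fact k)"
      by (simp add: norm_power divide_inverse_commute)
    finally show "norm (t ^ k / (fact k * fact (k + n))) \<le> norm (t ^ k /\<^sub>R fact k)" .
  qed
  then show ?thesis
    unfolding bessel_kernel_def by (rule summable_sums)
qed

text \<open>Once \<open>(z / 2) ^ n\<close> is taken out, the series depends on \<open>z\<close>
  only through its square. A choice of sign of \<open>z\<close> can thus affect only this
  power.\<close>

lemma bessel_J_eq_kernel: "bessel_J n z = (z / 2) ^ n * bessel_kernel n (- ((z / 2)\<^sup>2))"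
proof -
  have "(\<lambda>k. (z / 2) ^ n * ((- ((z / 2)\<^sup>2)) ^ k / (fact k * fact (k + n)))) sums
      ((z / 2) ^ n * bessel_kernel n (- ((z / 2)\<^sup>2)))"
    by (intro sums_mult bessel_kernel_sums)
  moreover have "(z / 2) ^ n * ((- ((z / 2)\<^sup>2)) ^ k / (fact k * fact (k + n))) =
      (- 1) ^ k / (of_nat (fact k) * of_nat (fact (k + n))) * (z / 2) ^ (2 * k + n)" for k
  proof -
    have "(- ((z / 2)\<^sup>2)) ^ k = (- 1) ^ k * (z / 2) ^ (2 * k)"
      by (metis power_minus power_mult)
    then show ?thesis
      by (simp only: power_add of_nat_fact times_divide_eq_right times_divide_eq_left mult_ac)
  qed
  ultimately show ?thesis
    unfolding bessel_J_def by (simp add: sums_iff)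
qed

text \<open>The exponents 0, 1 and 2 are the ones that the entries of the inverse matrix produce.
  Against powers of \<open>u * v\<close>, exponent 0 leaves a surplus factor \<open>v\<close> after
  an index shift, and exponent 2 a surplus factor \<open>u\<close>.\<close>

lemma contour_integral_exp_exp_inverse:
  assumes "r > 0"
  shows "contour_integral (circlepath 0 r) (\<lambda>z. exp (u * z + v / z)) =
      2 * of_real pi * \<i> * (v * bessel_kernel 1 (u * v))"
    and "contour_integral (circlepath 0 r) (\<lambda>z. exp (u * z + v / z) / z) =
      2 * of_real pi * \<i> * bessel_kernel 0 (u * v)"
    and "contour_integral (circlepath 0 r) (\<lambda>z. exp (u * z + v / z) / z\<^sup>2) =
      2 * of_real pi * \<i> * (u * bessel_kernel 1 (u * v))"
proof -
  note sums = contour_integral_exp_exp_inverse_sums[OF assms, of v _ u]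
  define c where "c k = 2 * of_real pi * \<i> * (v ^ k / fact k *
      (if k = 0 then 0 else u ^ (k - 1) / fact (k - 1)))" for k
  \<comment> \<open>\<open>c 0\<close> is 0; adding it gives the shape in which
    \<open>sums_Suc_iff\<close> drops the first term.\<close>
  have "c sums (contour_integral (circlepath 0 r) (\<lambda>z. exp (u * z + v / z)) + c 0)"
    using sums[of 0] by (simp add: c_def[abs_def] cong: if_cong)
  then have "(\<lambda>k. c (Suc k)) sums contour_integral (circlepath 0 r) (\<lambda>z. exp (u * z + v / z))"
    by (simp only: sums_Suc_iff)
  moreover have "(\<lambda>k. 2 * of_real pi * \<i> * (v * ((u * v) ^ k / (fact k * fact (k + 1))))) sums
      (2 * of_real pi * \<i> * (v * bessel_kernel 1 (u * v)))"
    by (intro sums_mult bessel_kernel_sums)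
  moreover have "c (Suc k) = 2 * of_real pi * \<i> * (v * ((u * v) ^ k / (fact k * fact (k + 1))))"
    for k
    by (simp add: c_def power_mult_distrib mult_ac del: fact_Suc)
  ultimately show "contour_integral (circlepath 0 r) (\<lambda>z. exp (u * z + v / z)) =
      2 * of_real pi * \<i> * (v * bessel_kernel 1 (u * v))"
    by (simp add: sums_iff)
  have "(\<lambda>k. 2 * of_real pi * \<i> * ((u * v) ^ k / (fact k * fact (k + 0)))) sums
      (2 * of_real pi * \<i> * bessel_kernel 0 (u * v))"
    by (intro sums_mult bessel_kernel_sums)
  then show "contour_integral (circlepath 0 r) (\<lambda>z. exp (u * z + v / z) / z) =
      2 * of_real pi * \<i> * bessel_kernel 0 (u * v)"
    using sums[of 1] by (simp add: sums_iff power_mult_distrib mult_ac)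
  have "(\<lambda>k. 2 * of_real pi * \<i> * (u * ((u * v) ^ k / (fact k * fact (k + 1))))) sums
      (2 * of_real pi * \<i> * (u * bessel_kernel 1 (u * v)))"
    by (intro sums_mult bessel_kernel_sums)
  then show "contour_integral (circlepath 0 r) (\<lambda>z. exp (u * z + v / z) / z\<^sup>2) =
      2 * of_real pi * \<i> * (u * bessel_kernel 1 (u * v))"
    using sums[of 2] by (simp add: sums_iff power_mult_distrib mult_ac del: fact_Suc)
qed

section \<open>The double contour integral and the entries of \<open>G_matrix\<close>\<close>

lemma contour_integral_twice_pole:
  assumes "r1 > 0" and "r2 > 0" and "norm p < r1 * r2" and "f holomorphic_on UNIV"
  shows "contour_integral (circlepath 0 r1) (\<lambda>z1.
      contour_integral (circlepath 0 r2) (\<lambda>z2. g z1 * (f z2 / (z1 * z2 - p)))) =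
    2 * of_real pi * \<i> * contour_integral (circlepath 0 r1) (\<lambda>z. g z * f (p / z) / z)"
proof -
  have "contour_integral (circlepath 0 r2) (\<lambda>z2. g z1 * (f z2 / (z1 * z2 - p))) =
      2 * of_real pi * \<i> * (g z1 * f (p / z1) / z1)" if "z1 \<in> path_image (circlepath 0 r1)" for z1
  proof (rule contour_integral_pole_divide[OF assms(2) _ _ assms(4)])
    have "norm z1 = r1"
      using that assms(1) by simp
    then show "z1 \<noteq> 0" "norm (p / z1) < r2"
      using assms(1,3) by (auto simp: norm_divide divide_simps mult.commute)
  qed
  then have "contour_integral (circlepath 0 r1) (\<lambda>z1.
      contour_integral (circlepath 0 r2) (\<lambda>z2. g z1 * (f z2 / (z1 * z2 - p)))) =
    contour_integral (circlepath 0 r1) (\<lambda>z. 2 * of_real pi * \<i> * (g z * f (p / z) / z))"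
    by (rule contour_integral_eq)
  \<comment> \<open>As an integral over the unit interval, the expression lets the constant out
    without a proof of integrability.\<close>
  then show ?thesis
    by (simp only: contour_integral_integral mult.assoc integral_mult_right)
qed


lemma contour_integral_inverse_2:
  fixes a b :: complex and u1 u2 r1 r2 :: real
  defines "c \<equiv> 1 / (2 * of_real pi * \<i>)\<^sup>2"
    and "p \<equiv> a * b"
  defines "I \<equiv> \<lambda>l m. c * contour_integral (circlepath 0 r1) (\<lambda>z1.
      contour_integral (circlepath 0 r2) (\<lambda>z2.
        matrix_inv (vector [vector [z1, a], vector [b, z2]] :: complex^2^2) $ l $ m *
        exp (of_real u1 * z1 + of_real u2 * z2)))"
  assumes r: "r1 > 0" "r2 > 0" and p_less: "norm (a * b) < r1 * r2"
  shows "I 1 1 = of_real u1 * p * bessel_kernel 1 (of_real (u1 * u2) * p)"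
    and "I 1 2 = - a * bessel_kernel 0 (of_real (u1 * u2) * p)"
    and "I 2 1 = - b * bessel_kernel 0 (of_real (u1 * u2) * p)"
    and "I 2 2 = of_real u2 * p * bessel_kernel 1 (of_real (u1 * u2) * p)"
proof -
  have c: "c * (2 * of_real pi * \<i> * (e * (2 * of_real pi * \<i> * x))) = e * x" for e x
    by (simp add: c_def power2_eq_square mult.left_commute[of e])
  \<comment> \<open>Common scheme for the four entries: \<open>g\<close> and \<open>f\<close>
    separate the numerator into its \<open>z1\<close> and \<open>z2\<close> parts, \<open>h\<close>
    is one of the three known outer integrands, \<open>e\<close> the constant left over and
    \<open>x\<close> the residue of \<open>h\<close>.\<close>
  have I_eq: "I l m = e * x"
    if entry: "\<And>z1 z2. z1 * z2 - p \<noteq> 0 \<Longrightarrow>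
        matrix_inv (vector [vector [z1, a], vector [b, z2]] :: complex^2^2) $ l $ m *
          exp (of_real u1 * z1 + of_real u2 * z2) = g z1 * (f z2 / (z1 * z2 - p))"
      and f: "f holomorphic_on UNIV"
      and outer: "\<And>z. z \<noteq> 0 \<Longrightarrow> g z * f (p / z) / z = e * h z"
      and h: "contour_integral (circlepath 0 r1) h = 2 * of_real pi * \<i> * x"
    for l m f g h e x
  proof -
    have "z1 * z2 - p \<noteq> 0" if "z1 \<in> path_image (circlepath 0 r1)" "z2 \<in> path_image (circlepath 0 r2)"
      for z1 z2
    proof -
      have "norm (z1 * z2) = r1 * r2"
        using that r by (simp add: norm_mult)
      then show ?thesis
        using p_less by (auto simp: p_def)
    qed
    then have "I l m = c * contour_integral (circlepath 0 r1) (\<lambda>z1.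
        contour_integral (circlepath 0 r2) (\<lambda>z2. g z1 * (f z2 / (z1 * z2 - p))))"
      unfolding I_def by (intro arg_cong[of _ _ "(*) c"] contour_integral_eq entry)
    also have "\<dots> = c * (2 * of_real pi * \<i> *
        contour_integral (circlepath 0 r1) (\<lambda>z. g z * f (p / z) / z))"
      using contour_integral_twice_pole[OF r _ f, of p g] p_less by (simp add: p_def)
    also have "contour_integral (circlepath 0 r1) (\<lambda>z. g z * f (p / z) / z) =
        contour_integral (circlepath 0 r1) (\<lambda>z. e * h z)"
      using r by (intro contour_integral_eq outer) auto
    also have "\<dots> = e * (2 * of_real pi * \<i> * x)"
      by (simp only: contour_integral_integral mult.assoc integral_mult_right
          h[unfolded contour_integral_integral])
    finally show ?thesis
      by (simp only: c)
  qed
  let ?E = "\<lambda>z. exp (of_real u1 * z + (of_real u2 * p) / z)"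
  have arg: "of_real u1 * (of_real u2 * p) = of_real (u1 * u2) * p"
    by simp
  note outer = contour_integral_exp_exp_inverse[OF r(1), of "of_real u1" "of_real u2 * p",
      unfolded arg]
  \<comment> \<open>The numerator \<open>z2\<close> becomes \<open>p / z\<close> at the pole, which
    with the factor \<open>1 / z\<close> of the residue gives \<open>p / z\<^sup>2\<close>. Off the
    diagonal the numerator is constant, so \<open>1 / z\<close> remains.\<close>
  have "I 1 1 = p * (of_real u1 * bessel_kernel 1 (of_real (u1 * u2) * p))"
    by (rule I_eq[where g = "\<lambda>z. exp (of_real u1 * z)" and f = "\<lambda>z. z * exp (of_real u2 * z)"
          and h = "\<lambda>z. ?E z / z\<^sup>2"])
       (use outer(3) in \<open>auto simp: p_def matrix_inv_2 exp_add power2_eq_square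
          intro!: holomorphic_intros\<close>)
  then show "I 1 1 = of_real u1 * p * bessel_kernel 1 (of_real (u1 * u2) * p)"
    by simp
  show "I 1 2 = - a * bessel_kernel 0 (of_real (u1 * u2) * p)"
    by (rule I_eq[where g = "\<lambda>z. - a * exp (of_real u1 * z)" and f = "\<lambda>z. exp (of_real u2 * z)"
          and h = "\<lambda>z. ?E z / z"])
       (use outer(2) in \<open>auto simp: p_def matrix_inv_2 exp_add intro!: holomorphic_intros\<close>)
  show "I 2 1 = - b * bessel_kernel 0 (of_real (u1 * u2) * p)"
    by (rule I_eq[where g = "\<lambda>z. - b * exp (of_real u1 * z)" and f = "\<lambda>z. exp (of_real u2 * z)"
          and h = "\<lambda>z. ?E z / z"])
       (use outer(2) in \<open>auto simp: p_def matrix_inv_2 exp_add intro!: holomorphic_intros\<close>)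
  \<comment> \<open>Here the numerator \<open>z1\<close> cancels the factor \<open>1 / z\<close>;
    the explicit 1 plays the part of \<open>e\<close>.\<close>
  have "I 2 2 = 1 * (of_real u2 * p * bessel_kernel 1 (of_real (u1 * u2) * p))"
    by (rule I_eq[where g = "\<lambda>z. z * exp (of_real u1 * z)" and f = "\<lambda>z. exp (of_real u2 * z)"
          and h = "?E"])
       (use outer(1) in \<open>auto simp: p_def matrix_inv_2 exp_add intro!: holomorphic_intros\<close>)
  then show "I 2 2 = of_real u2 * p * bessel_kernel 1 (of_real (u1 * u2) * p)"
    by simp
qed

lemma G_matrix_entries:
  fixes y1 y2 :: "real^'d"
  assumes "admissible_radius W lam y1 y2 r1" "admissible_radius W lam y1 y2 r2"
  defines "A \<equiv> T_matrix W lam y1 y2" and "B \<equiv> T_matrix W lam y2 y1"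
  defines "p \<equiv> - 4 * of_real pi ^ 2 * A * B"
  shows "G_matrix W lam r1 r2 u1 u2 y1 y2 $ 1 $ 1 =
      of_real u1 * p * bessel_kernel 1 (of_real (u1 * u2) * p)"
    and "G_matrix W lam r1 r2 u1 u2 y1 y2 $ 1 $ 2 =
      - (2 * of_real pi * \<i> * A) * bessel_kernel 0 (of_real (u1 * u2) * p)"
    and "G_matrix W lam r1 r2 u1 u2 y1 y2 $ 2 $ 1 =
      - (2 * of_real pi * \<i> * B) * bessel_kernel 0 (of_real (u1 * u2) * p)"
    and "G_matrix W lam r1 r2 u1 u2 y1 y2 $ 2 $ 2 =
      of_real u2 * p * bessel_kernel 1 (of_real (u1 * u2) * p)"
proof -
  define M where "M = max (norm A) (norm B)"
  have M: "0 \<le> M" "norm A \<le> M" "norm B \<le> M"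
    by (auto simp: M_def le_max_iff_disj)
  have r: "r1 > 4 * pi * M" "r2 > 4 * pi * M"
    using assms by (auto simp: admissible_radius_def M_def)
  \<comment> \<open>\<open>M\<close> may be 0, so the product estimate needs only
    \<open>0 \<le> 2 * pi * M\<close>, with both radii strictly above that value.\<close>
  have nonneg: "0 \<le> 2 * pi * M" and le: "2 * pi * M \<le> 4 * pi * M"
    using M(1) by auto
  then have pos: "r1 > 0" "r2 > 0"
    using r by linarith+
  have "norm ((2 * of_real pi * \<i> * A) * (2 * of_real pi * \<i> * B)) =
      (2 * pi * norm A) * (2 * pi * norm B)"
    by (simp add: norm_mult)
  also have "\<dots> \<le> (2 * pi * M) * (2 * pi * M)"
    using M by (intro mult_mono mult_left_mono) auto
  also have "\<dots> < r1 * r2"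
    using r nonneg le by (intro mult_strict_mono') linarith+
  finally have less: "norm ((2 * of_real pi * \<i> * A) * (2 * of_real pi * \<i> * B)) < r1 * r2" .
  have p: "p = (2 * of_real pi * \<i> * A) * (2 * of_real pi * \<i> * B)"
    by (simp add: p_def power2_eq_square)
  note entries = contour_integral_inverse_2[OF pos less, of u1 u2, folded p]
  show "G_matrix W lam r1 r2 u1 u2 y1 y2 $ 1 $ 1 =
      of_real u1 * p * bessel_kernel 1 (of_real (u1 * u2) * p)"
    "G_matrix W lam r1 r2 u1 u2 y1 y2 $ 1 $ 2 =
      - (2 * of_real pi * \<i> * A) * bessel_kernel 0 (of_real (u1 * u2) * p)"
    "G_matrix W lam r1 r2 u1 u2 y1 y2 $ 2 $ 1 =
      - (2 * of_real pi * \<i> * B) * bessel_kernel 0 (of_real (u1 * u2) * p)"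
    "G_matrix W lam r1 r2 u1 u2 y1 y2 $ 2 $ 2 =
      of_real u2 * p * bessel_kernel 1 (of_real (u1 * u2) * p)"
    using entries by (simp_all only: G_matrix_def resolvent_arg_def A_def B_def vec_lambda_beta)
qed

theorem mainTheorem2:
  fixes W :: "real^'d \<Rightarrow> real"
    and lam u1 u2 r1 r2 s1 s2 :: real
    and y1 y2 :: "real^'d"
    and sq :: "complex \<Rightarrow> complex"
  assumes "CARD('d) \<ge> 3"
    and "schwartz W"
    and "lam > 0"
    and "T_series_converges W lam"
    and "u1 > 0" and "u2 > 0"
    and "on_shell y1 y2"
    and "admissible_radius W lam y1 y2 r1" and "admissible_radius W lam y1 y2 r2"
    and "admissible_radius W lam y2 y1 s1" and "admissible_radius W lam y2 y1 s2"
    and "\<And>z. (sq z)\<^sup>2 = z"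
  shows
    "(T_matrix W lam y1 y2 \<noteq> 0 \<longrightarrow>
        rho_factor W lam r1 r2 1 1 u1 u2 y1 y2 =
          rho_LB_factor W lam u1 u2 y1 y2 *
          norm (of_real u1 * T_matrix W lam y2 y1 / (of_real u2 * T_matrix W lam y1 y2)) *
          (norm (bessel_J 1 (4 * of_real pi *
             sq (of_real u1 * of_real u2 * T_matrix W lam y1 y2 * T_matrix W lam y2 y1))))\<^sup>2)
     \<and> rho_factor W lam r1 r2 1 2 u1 u2 y1 y2 =
          rho_LB_factor W lam u1 u2 y1 y2 *
          (norm (bessel_J 0 (4 * of_real pi *
             sq (of_real u1 * of_real u2 * T_matrix W lam y1 y2 * T_matrix W lam y2 y1))))\<^sup>2
     \<and> rho_factor W lam r1 r2 2 2 u1 u2 y1 y2 = rho_factor W lam s1 s2 1 1 u2 u1 y2 y1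
     \<and> rho_factor W lam r1 r2 2 1 u1 u2 y1 y2 = rho_factor W lam s1 s2 1 2 u2 u1 y2 y1"
proof -
  define A B where "A = T_matrix W lam y1 y2" and "B = T_matrix W lam y2 y1"
  define p where "p = - 4 * of_real pi ^ 2 * A * B"
  define E where "E = exp (- u1 * Sigma_tot W lam y1 - u2 * Sigma_tot W lam y2)"
  define q where "q = sq (of_real u1 * of_real u2 * A * B)"
  define K where "K n = bessel_kernel n (of_real (u1 * u2) * p)" for n
  have q2: "q\<^sup>2 = of_real u1 * of_real u2 * A * B"
    unfolding q_def by (rule assms)
  \<comment> \<open>Half the argument is \<open>2 * of_real pi * q\<close>, and minus its square is
    \<open>of_real (u1 * u2) * p\<close>.\<close>
  have bessel: "bessel_J n (4 * of_real pi * q) = (2 * of_real pi * q) ^ n * K n" for n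
    using q2 by (simp add: bessel_J_eq_kernel K_def p_def power_mult_distrib mult_ac)
  \<comment> \<open>The choice of root enters the densities only through \<open>norm q\<close>,
    which \<open>q\<^sup>2\<close> determines; hence any \<open>sq\<close> will do.\<close>
  have normq: "(norm q)\<^sup>2 = u1 * u2 * norm A * norm B"
    using q2 assms(5,6) by (metis norm_power norm_mult norm_of_real abs_of_pos)
  note G = G_matrix_entries[OF assms(8,9), of u1 u2, folded A_def B_def, folded p_def,
      folded K_def]
  \<comment> \<open>Exchanging the points together with the times fixes \<open>p\<close> and the
    product of the times, hence also \<open>K\<close>.\<close>
  have p_swap: "- 4 * of_real pi ^ 2 * B * A = p" and u_swap: "u2 * u1 = u1 * u2"
    by (simp_all add: p_def mult_ac)
  note G' = G_matrix_entries[OF assms(10,11), of u2 u1, folded A_def B_def, unfolded p_swap u_swap,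
      folded K_def]
  have E': "exp (- u2 * Sigma_tot W lam y2 - u1 * Sigma_tot W lam y1) = E"
    by (simp add: E_def algebra_simps)
  have LB: "rho_LB_factor W lam u1 u2 y1 y2 = E * (4 * pi\<^sup>2 * (norm A)\<^sup>2)"
    by (simp only: rho_LB_factor_def Sigma_factor_def E_def A_def)
  have "A \<noteq> 0 \<longrightarrow> rho_factor W lam r1 r2 1 1 u1 u2 y1 y2 = rho_LB_factor W lam u1 u2 y1 y2 *
      norm (of_real u1 * B / (of_real u2 * A)) * (norm (bessel_J 1 (4 * of_real pi * q)))\<^sup>2"
    (is "_ \<longrightarrow> ?eq")
  proof
    assume "A \<noteq> 0"
    \<comment> \<open>Splits off \<open>(norm q)\<^sup>2\<close>, the factor that
      \<open>bessel_J 1\<close> contributes; what is left is the prefactor of the claim.\<close>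
    have ratio: "(u1 * norm B)\<^sup>2 =
        norm (of_real u1 * B / (of_real u2 * A)) * (u1 * u2 * norm A * norm B)"
      using \<open>A \<noteq> 0\<close> assms(5,6) by (simp add: norm_mult norm_divide power2_eq_square)
    have "rho_factor W lam r1 r2 1 1 u1 u2 y1 y2 =
        (u1 * (4 * pi\<^sup>2 * norm A * norm B) * norm (K 1))\<^sup>2 * E"
      using assms(5) by (simp add: rho_factor_def G E_def p_def norm_mult norm_power)
    also have "\<dots> = rho_LB_factor W lam u1 u2 y1 y2 * ((u1 * norm B)\<^sup>2 * (4 * pi\<^sup>2 * (norm (K 1))\<^sup>2))"
      by (simp add: LB power2_eq_square mult_ac)
    also have "\<dots> = rho_LB_factor W lam u1 u2 y1 y2 * norm (of_real u1 * B / (of_real u2 * A)) *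
        (4 * pi\<^sup>2 * (u1 * u2 * norm A * norm B) * (norm (K 1))\<^sup>2)"
      unfolding ratio by (simp only: mult_ac)
    also have "4 * pi\<^sup>2 * (u1 * u2 * norm A * norm B) * (norm (K 1))\<^sup>2 =
        (norm (bessel_J 1 (4 * of_real pi * q)))\<^sup>2"
      by (simp add: bessel norm_mult power_mult_distrib flip: normq)
    finally show ?eq .
  qed
  \<comment> \<open>For \<open>n = 0\<close> the Bessel value is \<open>K 0\<close> itself, and the
    squared norm of the prefactor \<open>2 * of_real pi * \<i> * A\<close> is exactly
    \<open>Sigma_factor\<close>.\<close>
  moreover have "rho_factor W lam r1 r2 1 2 u1 u2 y1 y2 =
      rho_LB_factor W lam u1 u2 y1 y2 * (norm (bessel_J 0 (4 * of_real pi * q)))\<^sup>2"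
    unfolding rho_factor_def E_def[symmetric] LB
    by (simp add: G bessel norm_mult power_mult_distrib)
  \<comment> \<open>The closed forms contain no radius, so the two sides may use different
    circles.\<close>
  moreover have "rho_factor W lam r1 r2 2 2 u1 u2 y1 y2 = rho_factor W lam s1 s2 1 1 u2 u1 y2 y1"
    "rho_factor W lam r1 r2 2 1 u1 u2 y1 y2 = rho_factor W lam s1 s2 1 2 u2 u1 y2 y1"
    unfolding rho_factor_def E' E_def[symmetric] by (simp_all only: G G')
  ultimately show ?thesis
    unfolding A_def[symmetric] B_def[symmetric] q_def[symmetric] by (intro conjI)
qed

end
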